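(* Let $\mathcal{P}_1$ be the set of degree-$\le1$ polynomials from $\{0,1\}^n$ to $\mathbb{R}$. There are absolute constants $c,C>0$ such that for every $\delta< c\log\log n/\log n$, $\mathcal{P}_1$ has a $(\delta,q)$-local correction algorithm with $q\le C\log n/\log\log n$.
   Context: $\mathcal{P}_1$ consists of the functions $x\mapsto a_0+\sum_{i=1}^n a_ix_i$ with $a_i\in\mathbb{R}$, $x\in\{0,1\}^n$. $\delta(f,P)=\Pr_{x\sim\{0,1\}^n}[f(x)\ne P(x)]$. A class $\mathcal{F}$ has a $(\delta,q)$-local correction algorithm if there is a probabilistic algorithm that, given oracle access to any $f$ with $\delta(f,P)\le\delta$ for some $P\in\mathcal{F}$ and any input $a\in\{0,1\}^n$, outputs $P(a)$ with probability at least $3/4$ using at most $q$ queries. *)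

theory Defs
  imports "HOL-Probability.Probability"
begin

definition cube :: "nat \<Rightarrow> (nat \<Rightarrow> real) set" where
  "cube n = ({1..n} \<rightarrow>\<^sub>E {0, 1})"

text \<open>Membership constrains a function on the cube only; its values elsewhere are irrelevant.\<close>

definition poly_deg_le_1 :: "nat \<Rightarrow> ((nat \<Rightarrow> real) \<Rightarrow> real) set" where
  "poly_deg_le_1 n =
     {P. \<exists>(a0 :: real) (a :: nat \<Rightarrow> real). \<forall>x \<in> cube n. P x = a0 + (\<Sum>i = 1..n. a i * x i)}"

definition rel_dist :: "nat \<Rightarrow> ((nat \<Rightarrow> real) \<Rightarrow> real) \<Rightarrow> ((nat \<Rightarrow> real) \<Rightarrow> real) \<Rightarrow> real" where
  "rel_dist n f P = measure_pmf.prob (pmf_of_set (cube n)) {x. f x \<noteq> P x}"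

text \<open>Deterministic adaptive query algorithms with queries in \<open>'x\<close>, oracle answers in \<open>'y\<close> and
  output in \<open>'r\<close>. A probabilistic oracle algorithm is a distribution over these: its coins are
  tossed in advance.\<close>

datatype ('x, 'y, 'r) query_tree =
    Output 'r
  | Query 'x "'y \<Rightarrow> ('x, 'y, 'r) query_tree"

primrec run :: "('x \<Rightarrow> 'y) \<Rightarrow> ('x, 'y, 'r) query_tree \<Rightarrow> 'r" where
  "run f (Output r) = r"
| "run f (Query x k) = run f (k (f x))"

primrec queries :: "('x \<Rightarrow> 'y) \<Rightarrow> ('x, 'y, 'r) query_tree \<Rightarrow> 'x list" where
  "queries f (Output r) = []"
| "queries f (Query x k) = x # queries f (k (f x))"

text \<open>The algorithm depends on the input point \<open>a\<close> but not on \<open>f\<close> or \<open>P\<close>. The query bound holds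
  for every oracle and every outcome of the coins.\<close>

definition has_local_correction ::
    "nat \<Rightarrow> ((nat \<Rightarrow> real) \<Rightarrow> real) set \<Rightarrow> real \<Rightarrow> nat \<Rightarrow> bool" where
  "has_local_correction n F \<delta> q \<longleftrightarrow>
     (\<exists>A :: (nat \<Rightarrow> real) \<Rightarrow> (nat \<Rightarrow> real, real, real) query_tree pmf.
        (\<forall>a \<in> cube n. \<forall>T \<in> set_pmf (A a). \<forall>f.
            length (queries f T) \<le> q \<and> set (queries f T) \<subseteq> cube n) \<and>
        (\<forall>f. \<forall>P \<in> F. rel_dist n f P \<le> \<delta> \<longrightarrow>
            (\<forall>a \<in> cube n. measure_pmf.prob (A a) {T. run f T = P a} \<ge> 3 / 4)))"

end

theory Submission
  imports Defs "HOL-Library.Nat_Bijection" "HOL-Probability.Product_PMF"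
begin

text \<open>To correct at \<open>a\<close>, each coordinate \<open>i\<close> independently draws a random column of a sign matrix with
  \<open>k\<close> rows, and the \<open>r\<close>-th query flips \<open>a\<^sub>i\<close> according to the \<open>r\<close>-th entry. If a fixed combination of
  the rows, with coefficients of sum \<open>1\<close>, is identically \<open>1\<close>, then the same combination of the answers of
  an affine polynomial is its value at \<open>a\<close>. If every row has bias at most \<open>1 / n\<close>, each query has
  density at most \<open>(1 + 1 / n)\<^sup>n \<le> 3\<close> with respect to the uniform distribution, so a union bound
  tolerates \<open>\<delta> \<le> 1 / (12 k)\<close>.

  Such a matrix comes from an invertible \<open>k \<times> k\<close> sign matrix \<open>M\<close> and a vector \<open>w\<close> for which the entries
  of \<open>M w\<close> are \<open>0\<close> or \<open>1\<close> although the sum of all \<open>\<bar>w\<^sub>t\<bar>\<close> is at least \<open>n\<close>: draw column \<open>t\<close> with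
  probability proportional to \<open>\<bar>w\<^sub>t\<bar>\<close> and multiply it by the sign of \<open>w\<^sub>t\<close>. In the manner of Hastad and
  Alon-Vu, rows and columns are indexed by the subsets of a set of size \<open>s + 3\<close>, and \<open>w\<close> is prescribed
  by its Fourier transform, which grows to \<open>2 ^ (2 ^ s * (s + 2) / 2)\<close>, that is \<open>k ^ \<Omega>(k)\<close> for
  \<open>k = 2 ^ (s + 3)\<close>. Hence \<open>k = O(log n / log log n)\<close> queries suffice.\<close>

section \<open>Characters\<close>

text \<open>The Walsh characters, with sets standing for 0/1 vectors; points and frequencies play
  symmetric roles.\<close>

definition chi :: "nat set \<Rightarrow> nat set \<Rightarrow> real" where
  "chi a t = (-1) ^ card (a \<inter> t)"

lemma chi_cases: "chi a t = 1 \<or> chi a t = -1"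
  by (auto simp: chi_def minus_one_power_iff)

lemma chi_empty [simp]: "chi {} t = 1" "chi a {} = 1"
  by (simp_all add: chi_def)

lemma chi_commute: "chi a t = chi t a"
  by (simp add: chi_def Int_commute)

lemma chi_disjoint: "a \<inter> t = {} \<Longrightarrow> chi a t = 1"
  by (simp add: chi_def)

lemma chi_mult:
  assumes "finite a" "finite b"
  shows "chi a t * chi b t = chi (sym_diff a b) t"
proof -
  let ?I = "a \<inter> b \<inter> t" and ?A = "(a - b) \<inter> t" and ?B = "(b - a) \<inter> t"
  have a: "card (a \<inter> t) = card ?A + card ?I"
    using assms by (subst card_Un_disjoint [symmetric]) (auto intro!: arg_cong[of _ _ card])
  have b: "card (b \<inter> t) = card ?B + card ?I"
    using assms by (subst card_Un_disjoint [symmetric]) (auto intro!: arg_cong[of _ _ card])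
  have ab: "card (sym_diff a b \<inter> t) = card ?A + card ?B"
    using assms by (subst card_Un_disjoint [symmetric]) (auto intro!: arg_cong[of _ _ card])
  show ?thesis
    unfolding chi_def a b ab by (simp add: power_add minus_one_power_iff)
qed

text \<open>Adding \<open>x\<close> to \<open>b\<close> flips the sign exactly if
  \<open>x \<in> t\<close>, so each new element cancels or doubles the sum.\<close>

lemma sum_Pow_chi:
  assumes "finite X"
  shows "(\<Sum>b\<in>Pow X. chi t b) = (if t \<inter> X = {} then 2 ^ card X else 0)"
  using assms
proof (induction X)
  case empty
  then show ?case by simp
next
  case (insert x X)
  have step: "chi t (insert x b) = (if x \<in> t then - chi t b else chi t b)" if "b \<in> Pow X" for b
  proof -
    have "finite (t \<inter> b)" "x \<notin> b" using that insert finite_subset by auto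
    then show ?thesis by (auto simp: chi_def Int_insert_right)
  qed
  have "(\<Sum>b\<in>Pow (insert x X). chi t b)
      = (\<Sum>b\<in>Pow X. chi t b) + (\<Sum>b\<in>insert x ` Pow X. chi t b)"
    unfolding Pow_insert using insert by (intro sum.union_disjoint) auto
  also have "(\<Sum>b\<in>insert x ` Pow X. chi t b) = (\<Sum>b\<in>Pow X. chi t (insert x b))"
  proof (rule sum.reindex_cong[where l = "insert x"])
    show "inj_on (insert x) (Pow X)"
      using insert.hyps by (auto simp: inj_on_def)
  qed auto
  also have "\<dots> = (\<Sum>b\<in>Pow X. if x \<in> t then - chi t b else chi t b)"
    using step by (intro sum.cong) auto
  also have "\<dots> = (if x \<in> t then - (\<Sum>b\<in>Pow X. chi t b) else (\<Sum>b\<in>Pow X. chi t b))"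
    by (simp add: sum_negf)
  finally show ?case using insert by auto
qed

lemma chi_orthogonal:
  assumes "finite X" "a \<subseteq> X" "b \<subseteq> X"
  shows "(\<Sum>t\<in>Pow X. chi a t * chi b t) = (if a = b then 2 ^ card X else 0)"
proof -
  have fin: "finite a" "finite b" using assms finite_subset by auto
  have "sym_diff a b \<inter> X = {} \<longleftrightarrow> a = b" using assms by auto
  then show ?thesis
    using sum_Pow_chi[OF assms(1), of "sym_diff a b"] by (simp add: chi_mult fin)
qed

lemma chi_expansion:
  assumes "finite X" "t \<in> Pow X"
  shows "h t = (\<Sum>a\<in>Pow X. (\<Sum>u\<in>Pow X. h u * chi a u) / 2 ^ card X * chi a t)"
proof -
  have "(\<Sum>a\<in>Pow X. (\<Sum>u\<in>Pow X. h u * chi a u) / 2 ^ card X * chi a t)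
      = (\<Sum>a\<in>Pow X. \<Sum>u\<in>Pow X. h u / 2 ^ card X * (chi u a * chi t a))"
    by (intro sum.cong refl) (simp add: sum_divide_distrib sum_distrib_left sum_distrib_right chi_commute mult_ac)
  also have "\<dots> = (\<Sum>u\<in>Pow X. h u / 2 ^ card X * (\<Sum>a\<in>Pow X. chi u a * chi t a))"
    by (subst sum.swap) (simp add: sum_distrib_left)
  also have "\<dots> = (\<Sum>u\<in>Pow X. if u = t then h u else 0)"
    using assms by (intro sum.cong) (auto simp: chi_orthogonal)
  also have "\<dots> = h t" using assms by simp
  finally show ?thesis by simp
qed

text \<open>This is \<open>sum_Pow_chi\<close> with point and frequency exchanged. The indicator
  brings the characters of all subsets of \<open>a\<close> into one row.\<close>

lemma disjoint_indicator_chi: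
  assumes "finite a"
  shows "of_bool (a \<inter> t = {}) = (\<Sum>b\<in>Pow a. chi b t) / 2 ^ card a"
  using sum_Pow_chi[OF assms, of t] by (simp add: chi_commute Int_commute)


section \<open>A rapidly growing sequence of spectral values\<close>

text \<open>The recursion is what makes the functional of \<open>weight\<close> below vanish on the rows
  containing \<open>s + 2\<close>; each step multiplies by at least \<open>2 ^ (card (set_decode j) + 1)\<close>.\<close>

function coef :: "nat \<Rightarrow> real" where
  "coef 0 = 1"
| "coef (Suc j) = (2 ^ (card (set_decode j) + 2) - 1) * coef j
     - (\<Sum>i \<in> {i. i < j \<and> set_decode i \<subset> set_decode j}. coef i + coef (Suc i))"
  by pat_completeness auto
termination by (relation "Wellfounded.measure id") auto

declare coef.simps(2) [simp del] \<comment> \<open>loops: \<open>coef (Suc i)\<close> recurs under the sum\<close>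

lemma inj_set_decode: "inj set_decode"
  by (rule inj_on_inverseI[of _ set_encode]) simp

lemma card_psubset_decode_le: "card {i. i < j \<and> set_decode i \<subset> set_decode j} \<le> 2 ^ card (set_decode j) - 1"
proof -
  have "card {i. i < j \<and> set_decode i \<subset> set_decode j} = card (set_decode ` {i. i < j \<and> set_decode i \<subset> set_decode j})"
    by (rule card_image [symmetric]) (auto intro: inj_on_subset inj_set_decode)
  also have "\<dots> \<le> card (Pow (set_decode j) - {set_decode j})"
    by (intro card_mono) auto
  also have "\<dots> = 2 ^ card (set_decode j) - 1"
    by (simp add: card_Pow)
  finally show ?thesis .
qed

text \<open>With \<open>d = card (set_decode j)\<close>, the recursion subtracts at most
  \<open>2 ^ d - 1\<close> terms, each at most \<open>2 * coef j\<close>, which leaves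
  \<open>2 ^ (d + 1) + 1\<close> times \<open>coef j\<close>. Positivity and monotonicity are
  carried along because the bound on the terms uses them.\<close>

lemma coef_growth:
  "coef j > 0 \<and> (\<forall>i\<le>j. coef i \<le> coef j) \<and> coef (Suc j) \<ge> 2 ^ (card (set_decode j) + 1) * coef j"
proof (induction j rule: less_induct)
  case (less j)
  have 1: "coef j > 0 \<and> (\<forall>i\<le>j. coef i \<le> coef j)"
  proof (cases j)
    case 0
    then show ?thesis by simp
  next
    case (Suc m)
    have m: "coef m > 0" "\<forall>i\<le>m. coef i \<le> coef m"
       "coef j \<ge> 2 ^ (card (set_decode m) + 1) * coef m"
      using less[of m] Suc by auto
    have "1 * coef m \<le> 2 ^ (card (set_decode m) + 1) * coef m"
      using m(1) by (intro mult_right_mono one_le_power) auto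
    then have "coef m \<le> coef j" using m(3) by linarith
    then show ?thesis using m Suc by (auto simp: le_Suc_eq intro: order_trans)
  qed
  let ?S = "{i. i < j \<and> set_decode i \<subset> set_decode j}" and ?d = "card (set_decode j)"
  have "(\<Sum>i\<in>?S. coef i + coef (Suc i)) \<le> (\<Sum>i\<in>?S. 2 * coef j)"
    using 1 by (intro sum_mono) (smt (verit) Suc_leI less_imp_le mem_Collect_eq)
  also have "\<dots> = real (card ?S) * (2 * coef j)" by simp
  also have "\<dots> \<le> (2 ^ ?d - 1) * (2 * coef j)"
  proof (rule mult_right_mono)
    have "real (card ?S) \<le> real (2 ^ ?d - 1)" using card_psubset_decode_le[of j] by (simp only: of_nat_le_iff)
    then show "real (card ?S) \<le> 2 ^ ?d - 1" by (simp add: of_nat_diff)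
  qed (use 1 in auto)
  finally have "coef (Suc j) \<ge> (2 ^ (?d + 2) - 1) * coef j - (2 ^ ?d - 1) * (2 * coef j)"
    by (subst coef.simps(2)) simp
  also have "(2 ^ (?d + 2) - 1) * coef j - (2 ^ ?d - 1) * (2 * coef j)
      = 2 ^ (?d + 1) * coef j + coef j"
    by (simp add: algebra_simps)
  finally show ?case using 1 by simp
qed

lemma coef_ge_power_sum: "coef m \<ge> 2 ^ (\<Sum>j<m. card (set_decode j) + 1)"
proof (induction m)
  case (Suc m)
  have "2 ^ (\<Sum>j<Suc m. card (set_decode j) + 1)
      = 2 ^ (card (set_decode m) + 1) * (2 ^ (\<Sum>j<m. card (set_decode j) + 1) :: real)"
    by (simp add: power_add)
  also have "\<dots> \<le> 2 ^ (card (set_decode m) + 1) * coef m"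
    using Suc by (intro mult_left_mono) auto
  finally show ?case using coef_growth[of m] by linarith
qed simp

text \<open>A subset and its complement together have \<open>card X\<close> elements.\<close>

lemma sum_card_Pow: "finite X \<Longrightarrow> 2 * (\<Sum>y\<in>Pow X. card y) = card X * 2 ^ card X"
proof -
  assume fin: "finite X"
  have "(\<Sum>y\<in>Pow X. card y) = (\<Sum>y\<in>Pow X. card (X - y))"
    by (rule sum.reindex_bij_witness[of _ "\<lambda>y. X - y" "\<lambda>y. X - y"])
      (auto simp: double_diff)
  then have "2 * (\<Sum>y\<in>Pow X. card y) = (\<Sum>y\<in>Pow X. card y + card (X - y))"
    by (simp add: sum.distrib)
  also have "\<dots> = (\<Sum>y\<in>Pow X. card X)"
    using fin by (intro sum.cong refl) (auto simp: card_Diff_subset finite_subset card_mono)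
  finally show ?thesis using fin by (simp add: card_Pow)
qed

lemma bij_betw_set_decode: "bij_betw set_decode {..<2 ^ s} (Pow {..<s})"
proof (rule bij_betw_imageI)
  show inj: "inj_on set_decode {..<2 ^ s}"
    using inj_set_decode inj_on_subset by blast
  have "set_decode j \<subseteq> {..<s}" if "j < 2 ^ s" for j
  proof
    fix i assume i: "i \<in> set_decode j"
    have "2 ^ i \<le> j"
      using i by (metis div_less even_zero leI set_decode_def mem_Collect_eq)
    then have "(2::nat) ^ i < 2 ^ s" using that by linarith
    then show "i \<in> {..<s}" by simp
  qed
  then have "set_decode ` {..<2 ^ s} \<subseteq> Pow {..<s}" by auto
  moreover have "card (set_decode ` {..<2 ^ s}) = card (Pow {..<s})"
    using inj by (simp add: card_image card_Pow)
  ultimately show "set_decode ` {..<2 ^ s} = Pow {..<s}"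
    by (intro card_subset_eq) auto
qed

text \<open>Subsets of \<open>{..<s}\<close> have mean size \<open>s / 2\<close>; squaring avoids a
  division in the exponent.\<close>

lemma coef_power2_ge: "(coef (2 ^ s))\<^sup>2 \<ge> 2 ^ (2 ^ s * (s + 2))"
proof -
  have "(\<Sum>j<2 ^ s. card (set_decode j) + 1) = (\<Sum>y\<in>Pow {..<s}. card y + 1)"
    by (rule sum.reindex_bij_betw[OF bij_betw_set_decode])
  also have "\<dots> * 2 = 2 ^ s * (s + 2)"
    using sum_card_Pow[of "{..<s}"] unfolding sum.distrib by (simp add: card_Pow algebra_simps)
  finally have e: "(\<Sum>j<2 ^ s. card (set_decode j) + 1) * 2 = 2 ^ s * (s + 2)" .
  have "(2 ^ (\<Sum>j<2 ^ s. card (set_decode j) + 1))\<^sup>2 \<le> (coef (2 ^ s))\<^sup>2"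
    using coef_ge_power_sum by (intro power_mono) auto
  then show ?thesis unfolding power_mult[symmetric] e .
qed

lemma set_encode_psubset:
  assumes "finite y" "x \<subset> y" shows "set_encode x < set_encode y"
proof -
  have "(\<Sum>i\<in>x. 2 ^ i) < (\<Sum>i\<in>y. 2 ^ i :: nat)"
    using assms by (auto intro: sum_strict_mono2)
  then show ?thesis by (simp add: set_encode_def)
qed

section \<open>An ill-conditioned sign matrix\<close>

text \<open>A proper subset has a smaller code, so the recursion at \<open>set_encode y\<close> sums
  over all proper subsets of \<open>y\<close>; adding the term of \<open>y\<close> itself gives a
  sum over \<open>Pow y\<close>.\<close>

lemma coef_sum_Pow:
  assumes "finite y"
  shows "(\<Sum>z\<in>Pow y. coef (set_encode z) + coef (Suc (set_encode z)))
    = 2 ^ (card y + 2) * coef (set_encode y)"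
proof -
  let ?j = "set_encode y" and ?f = "\<lambda>i. coef i + coef (Suc i)"
  let ?S = "{i. i < ?j \<and> set_decode i \<subset> set_decode ?j}"
  have dec: "set_decode ?j = y" using assms by simp
  have fin: "finite z" if "z \<subseteq> y" for z using that assms finite_subset by auto
  have "(\<Sum>z\<in>Pow y. ?f (set_encode z)) = ?f ?j + (\<Sum>z\<in>Pow y - {y}. ?f (set_encode z))"
    using assms by (subst sum.remove[of _ y]) auto
  also have "(\<Sum>z\<in>Pow y - {y}. ?f (set_encode z)) = (\<Sum>i\<in>?S. ?f i)"
  proof (rule sum.reindex_bij_witness[of _ set_decode set_encode])
    fix z assume z: "z \<in> Pow y - {y}"
    then show "set_decode (set_encode z) = z" using fin by auto
    then show "set_encode z \<in> ?S"
      using z dec assms by (auto intro!: set_encode_psubset)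
  qed (use dec in auto)
  also have "?f ?j + \<dots> = 2 ^ (card y + 2) * coef ?j"
    using coef.simps(2)[of ?j] unfolding dec by (simp add: algebra_simps)
  finally show ?thesis .
qed

section \<open>The matrix, its weight vector and their product\<close>

definition active :: "nat \<Rightarrow> nat set \<Rightarrow> bool" where
  "active s a \<longleftrightarrow> {s, s + 1} \<subseteq> a"

definition idx :: "nat \<Rightarrow> nat set \<Rightarrow> nat" where
  "idx s a = set_encode (a \<inter> {..<s})"

text \<open>The predecessor, in the chain described below, of an active \<open>a\<close> without
  \<open>s + 2\<close>. \<open>sign_row\<close> consults it only for
  \<open>idx s a \<noteq> 0\<close>, where the subtraction is not truncated.\<close>

definition pred_set :: "nat \<Rightarrow> nat set \<Rightarrow> nat set" where
  "pred_set s a = {s, s + 1, s + 2} \<union> set_decode (idx s a - 1)"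

text \<open>The value grows within a pair of active sets of the same index, from
  \<open>coef j\<close> to \<open>coef (Suc j)\<close>; the next pair starts with the value at which
  this one ends.\<close>

definition spectrum :: "nat \<Rightarrow> nat set \<Rightarrow> real" where
  "spectrum s a = (if active s a then coef (if s + 2 \<in> a then Suc (idx s a) else idx s a) else 0)"

text \<open>The inverse Fourier transform of \<open>spectrum\<close>.\<close>

definition weight :: "nat \<Rightarrow> nat set \<Rightarrow> real" where
  "weight s t = (\<Sum>a\<in>Pow {..<s + 3}. spectrum s a * chi a t) / 2 ^ (s + 3)"

text \<open>The active sets are chained as \<open>A \<union> y\<^sub>0, A \<union> {e} \<union> y\<^sub>0, A \<union> y\<^sub>1, A \<union> {e} \<union> y\<^sub>1, \<dots>\<close> with
  \<open>A = {s, s + 1}\<close>, \<open>e = s + 2\<close> and \<open>y\<^sub>j = set_decode j\<close>. The last case has values \<open>\<plusminus>1\<close> because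
  \<open>(u - v + 1 + u v) / 2\<close> is \<open>1\<close> for \<open>u = 1\<close> and \<open>-v\<close> for \<open>u = -1\<close>; it carries the spectral value
  over from one pair of the chain to the next.\<close>

definition sign_row :: "nat \<Rightarrow> nat set \<Rightarrow> nat set \<Rightarrow> real" where
  "sign_row s a t =
     (if \<not> active s a then chi a t
      else if s + 2 \<in> a then chi (a - {s + 2}) t - 2 * of_bool (a \<inter> t = {})
      else if idx s a = 0 then chi a t
      else (chi a t - chi (pred_set s a) t + 1 + chi (sym_diff a (pred_set s a)) t) / 2)"

lemma finite_pred_set [simp]: "finite (pred_set s a)"
  by (simp add: pred_set_def)

lemma pred_set_props:
  assumes "a \<subseteq> {..<s + 3}" "idx s a \<noteq> 0"
  shows "pred_set s a \<subseteq> {..<s + 3}" "idx s (pred_set s a) = idx s a - 1"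
    "active s (pred_set s a)" "s + 2 \<in> pred_set s a"
proof -
  have b: "bij_betw set_decode {..<2 ^ s} (Pow {..<s})" by (rule bij_betw_set_decode)
  have "a \<inter> {..<s} \<in> Pow {..<s}" by auto
  then obtain j where j: "j < 2 ^ s" "a \<inter> {..<s} = set_decode j"
    using b by (metis bij_betw_def imageE lessThan_iff)
  then have "idx s a = j" by (simp add: idx_def)
  then have "idx s a - 1 < 2 ^ s" using j by simp
  then have "set_decode (idx s a - 1) \<in> Pow {..<s}"
    using bij_betwE[OF b] by blast
  then have sub: "set_decode (idx s a - 1) \<subseteq> {..<s}" by simp
  then show "pred_set s a \<subseteq> {..<s + 3}" by (auto simp: pred_set_def)
  have "pred_set s a \<inter> {..<s} = set_decode (idx s a - 1)"
    using sub by (auto simp: pred_set_def)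
  then show "idx s (pred_set s a) = idx s a - 1" unfolding idx_def[of s "pred_set s a"] by simp
qed (auto simp: pred_set_def active_def)

text \<open>Hence the product term of a linking row sits at a frequency where
  \<open>spectrum\<close> vanishes.\<close>

lemma not_active_sym_diff: "active s a \<Longrightarrow> active s b \<Longrightarrow> \<not> active s (sym_diff a b)"
  by (auto simp: active_def)

lemma sign_row_cases:
  assumes "a \<subseteq> {..<s + 3}"
  shows "sign_row s a t = 1 \<or> sign_row s a t = -1"
proof -
  have fa: "finite a" using assms finite_subset by auto
  have "chi (a - {s + 2}) t = 1" if "a \<inter> t = {}"
    using that by (intro chi_disjoint) auto
  moreover have "chi (sym_diff a (pred_set s a)) t = chi a t * chi (pred_set s a) t"
    by (simp add: chi_mult fa)
  ultimately show ?thesis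
    using chi_cases[of a t] chi_cases[of "pred_set s a" t] chi_cases[of "a - {s + 2}" t]
    by (auto simp: sign_row_def)
qed

lemma weight_chi:
  assumes "b \<subseteq> {..<s + 3}"
  shows "(\<Sum>t\<in>Pow {..<s + 3}. weight s t * chi b t) = spectrum s b"
proof -
  let ?X = "{..<s + 3}"
  have "(\<Sum>t\<in>Pow ?X. weight s t * chi b t)
      = (\<Sum>t\<in>Pow ?X. \<Sum>a\<in>Pow ?X. spectrum s a / 2 ^ (s + 3) * (chi a t * chi b t))"
    unfolding weight_def sum_divide_distrib sum_distrib_right
    by (intro sum.cong refl) (simp add: mult_ac)
  also have "\<dots> = (\<Sum>a\<in>Pow ?X. spectrum s a / 2 ^ (s + 3) * (\<Sum>t\<in>Pow ?X. chi a t * chi b t))"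
    by (subst sum.swap) (simp only: sum_distrib_left)
  also have "\<dots> = (\<Sum>a\<in>Pow ?X. if a = b then spectrum s a else 0)"
    using assms by (intro sum.cong refl) (auto simp: chi_orthogonal)
  also have "\<dots> = spectrum s b" using assms by simp
  finally show ?thesis .
qed

text \<open>The active subsets form two copies of \<open>Pow y\<close>, without and with
  \<open>s + 2\<close>, so that each \<open>z \<subseteq> y\<close> contributes the two terms summed
  in \<open>coef_sum_Pow\<close>.\<close>

lemma sum_spectrum_Pow:
  assumes "y \<subseteq> {..<s}"
  shows "(\<Sum>b\<in>Pow ({s, s + 1, s + 2} \<union> y). spectrum s b) = 2 ^ (card y + 2) * coef (set_encode y)"
proof -
  let ?U = "\<lambda>z. {s, s + 1} \<union> z" and ?V = "\<lambda>z. {s, s + 1, s + 2} \<union> z"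
  have fin: "finite y" using assms finite_subset by auto
  have int: "?U z \<inter> {..<s} = z" "?V z \<inter> {..<s} = z" if "z \<in> Pow y" for z
    using that assms by auto
  have inj: "inj_on ?U (Pow y)" "inj_on ?V (Pow y)"
    using int by (metis inj_onI)+
  have split: "{b \<in> Pow (?V y). active s b} = ?U ` Pow y \<union> ?V ` Pow y"
  proof (intro equalityI subsetI)
    fix b assume b: "b \<in> {b \<in> Pow (?V y). active s b}"
    then have "b \<inter> {..<s} \<in> Pow y" by auto
    moreover have "b = ?U (b \<inter> {..<s}) \<or> b = ?V (b \<inter> {..<s})"
      using b assms by (auto simp: active_def)
    ultimately show "b \<in> ?U ` Pow y \<union> ?V ` Pow y" by blast
  qed (auto simp: active_def)
  have "(\<Sum>b\<in>Pow (?V y). spectrum s b) = (\<Sum>b\<in>{b \<in> Pow (?V y). active s b}. spectrum s b)"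
    using fin by (intro sum.mono_neutral_right) (auto simp: spectrum_def)
  also have "\<dots> = (\<Sum>b\<in>?U ` Pow y. spectrum s b) + (\<Sum>b\<in>?V ` Pow y. spectrum s b)"
    unfolding split
  proof (rule sum.union_disjoint)
    have "s + 2 \<notin> b" if "b \<in> ?U ` Pow y" for b using that assms by auto
    moreover have "s + 2 \<in> b" if "b \<in> ?V ` Pow y" for b using that by auto
    ultimately show "?U ` Pow y \<inter> ?V ` Pow y = {}" by blast
  qed (use fin in auto)
  also have "(\<Sum>b\<in>?U ` Pow y. spectrum s b) = (\<Sum>z\<in>Pow y. coef (set_encode z))"
  proof (rule sum.reindex_cong[OF inj(1) refl])
    fix z assume z: "z \<in> Pow y"
    then have "s + 2 \<notin> ?U z" using assms by auto
    then show "spectrum s (?U z) = coef (set_encode z)"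
      unfolding spectrum_def idx_def int(1)[OF z] by (simp add: active_def)
  qed
  also have "(\<Sum>b\<in>?V ` Pow y. spectrum s b) = (\<Sum>z\<in>Pow y. coef (Suc (set_encode z)))"
  proof (rule sum.reindex_cong[OF inj(2) refl])
    fix z assume z: "z \<in> Pow y"
    then show "spectrum s (?V z) = coef (Suc (set_encode z))"
      unfolding spectrum_def idx_def int(2)[OF z] by (simp add: active_def)
  qed
  finally show ?thesis using coef_sum_Pow[OF fin] by (simp add: sum.distrib)
qed

lemma active_full_eq:
  assumes "a \<subseteq> {..<s + 3}" "active s a" "s + 2 \<in> a"
  shows "a = {s, s + 1, s + 2} \<union> (a \<inter> {..<s})"
  using assms by (auto simp: active_def)

text \<open>Each row is a combination of characters, and its product with \<open>weight\<close> is
  the same combination of spectral values. The value \<open>1\<close> comes only from the start of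
  the chain, as \<open>coef 0\<close>; all other rows give \<open>0\<close>.\<close>

lemma weight_sign_row:
  assumes a: "a \<subseteq> {..<s + 3}"
  shows "(\<Sum>t\<in>Pow {..<s + 3}. weight s t * sign_row s a t) \<in> {0, 1}"
proof -
  let ?W = "\<lambda>f. \<Sum>t\<in>Pow {..<s + 3}. weight s t * f t"
  have fa: "finite a" using a finite_subset by auto
  consider (low) "\<not> active s a" | (full) "active s a" "s + 2 \<in> a"
    | (first) "active s a" "s + 2 \<notin> a" "idx s a = 0" | (link) "active s a" "s + 2 \<notin> a" "idx s a \<noteq> 0"
    by blast
  then show ?thesis
  proof cases
    case low
    then show ?thesis using weight_chi[OF a] by (simp add: sign_row_def spectrum_def)
  next
    case first
    then show ?thesis using weight_chi[OF a] by (simp add: sign_row_def spectrum_def)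
  next
    case link
    let ?p = "pred_set s a"
    note p = pred_set_props[OF a link(3)]
    have d: "sym_diff a ?p \<subseteq> {..<s + 3}" using a p(1) by auto
    have "?W (sign_row s a) = (?W (chi a) - ?W (chi ?p) + ?W (chi {}) + ?W (chi (sym_diff a ?p))) / 2"
      using link by (simp add: sign_row_def sum_divide_distrib sum_subtractf [symmetric]
          sum.distrib [symmetric] algebra_simps)
    also have "\<dots> = (spectrum s a - spectrum s ?p + spectrum s {} + spectrum s (sym_diff a ?p)) / 2"
      using weight_chi[OF a] weight_chi[OF p(1)] weight_chi[OF d] weight_chi[of "{}" s] by simp
    \<comment> \<open>The first two values agree because \<open>idx s a\<close> is
      \<open>Suc (idx s ?p)\<close>; the other two sets are inactive.\<close>
    also have "\<dots> = 0"
      using link p not_active_sym_diff[OF link(1) p(3)]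
      by (simp add: spectrum_def) (simp add: active_def)
    finally show ?thesis by simp
  next
    case full
    let ?y = "a \<inter> {..<s}"
    have aeq: "a = {s, s + 1, s + 2} \<union> ?y" using active_full_eq[OF a full] .
    have "card a = card {s, s + 1, s + 2} + card ?y"
      by (subst aeq, subst card_Un_disjoint) auto
    then have card: "card a = card ?y + 3" by simp
    have m: "a - {s + 2} \<subseteq> {..<s + 3}" using a by auto
    have idx: "idx s (a - {s + 2}) = set_encode ?y"
      unfolding idx_def by (intro arg_cong[of _ _ set_encode]) auto
    have "?W (sign_row s a) = ?W (chi (a - {s + 2})) - 2 * ?W (\<lambda>t. of_bool (a \<inter> t = {}))"
      using full unfolding sum_distrib_left sum_subtractf [symmetric]
      by (intro sum.cong refl) (simp add: sign_row_def algebra_simps)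
    also have "?W (\<lambda>t. of_bool (a \<inter> t = {})) = (\<Sum>t\<in>Pow {..<s + 3}. \<Sum>b\<in>Pow a. weight s t * chi b t) / 2 ^ card a"
      unfolding disjoint_indicator_chi[OF fa] by (simp add: sum_distrib_left sum_divide_distrib)
    also have "(\<Sum>t\<in>Pow {..<s + 3}. \<Sum>b\<in>Pow a. weight s t * chi b t) = (\<Sum>b\<in>Pow a. ?W (chi b))"
      by (rule sum.swap)
    also have "\<dots> = (\<Sum>b\<in>Pow a. spectrum s b)"
      using a by (intro sum.cong refl weight_chi) auto
    also have "\<dots> = 2 ^ (card ?y + 2) * coef (set_encode ?y)"
      by (subst aeq, rule sum_spectrum_Pow) auto
    also have "?W (chi (a - {s + 2})) = coef (set_encode ?y)"
      unfolding weight_chi[OF m] using full(1) idx by (simp add: spectrum_def active_def)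
    \<comment> \<open>As \<open>card a\<close> is \<open>card ?y + 3\<close>, the mean over
      \<open>Pow a\<close> is half of \<open>coef (set_encode ?y)\<close>, and twice the mean
      cancels the first term.\<close>
    finally show ?thesis by (simp add: card power_add)
  qed
qed

text \<open>The full set \<open>{..<s + 3}\<close> ends the chain with spectral value
  \<open>coef (2 ^ s)\<close>, and a Fourier coefficient is at most the sum of absolute
  values.\<close>

lemma sum_abs_weight_ge: "(\<Sum>t\<in>Pow {..<s + 3}. \<bar>weight s t\<bar>) \<ge> coef (2 ^ s)"
proof -
  let ?a = "{..<s + 3}"
  have "?a \<inter> {..<s} = {..<s}" by auto
  then have "Suc (idx s ?a) = 2 ^ s"
    unfolding idx_def set_encode_def by (simp add: lessThan_atLeast0 sum_power2)
  then have "coef (2 ^ s) = (\<Sum>t\<in>Pow ?a. weight s t * chi ?a t)"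
    using weight_chi[of ?a s] by (simp add: spectrum_def active_def)
  also have "\<dots> \<le> (\<Sum>t\<in>Pow ?a. \<bar>weight s t\<bar>)"
  proof (rule sum_mono)
    fix t
    show "weight s t * chi ?a t \<le> \<bar>weight s t\<bar>" using chi_cases[of ?a t] by auto
  qed
  finally show ?thesis .
qed

section \<open>Invertibility of the matrix, as spanning by its rows\<close>

definition row_span :: "nat \<Rightarrow> (nat set \<Rightarrow> real) \<Rightarrow> bool" where
  "row_span s f \<longleftrightarrow> (\<exists>c. \<forall>t\<in>Pow {..<s + 3}. (\<Sum>a\<in>Pow {..<s + 3}. c a * sign_row s a t) = f t)"

lemma row_span_cong:
  "row_span s f \<Longrightarrow> (\<And>t. t \<subseteq> {..<s + 3} \<Longrightarrow> f t = g t) \<Longrightarrow> row_span s g"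
  by (auto simp: row_span_def)

lemma row_span_row: "a \<subseteq> {..<s + 3} \<Longrightarrow> row_span s (sign_row s a)"
  unfolding row_span_def by (rule exI[of _ "\<lambda>b. of_bool (b = a)"]) (auto simp: if_distrib[of "\<lambda>x. x * _"] of_bool_def cong: if_cong)

lemma row_span_scale: assumes "row_span s f" shows "row_span s (\<lambda>t. r * f t)"
proof -
  obtain c where "\<forall>t\<in>Pow {..<s + 3}. (\<Sum>a\<in>Pow {..<s + 3}. c a * sign_row s a t) = f t"
    using assms by (auto simp: row_span_def)
  then show ?thesis unfolding row_span_def
    by (intro exI[of _ "\<lambda>a. r * c a"]) (simp add: mult.assoc flip: sum_distrib_left)
qed

lemma row_span_add:
  assumes "row_span s f" "row_span s g" shows "row_span s (\<lambda>t. f t + g t)"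
proof -
  obtain c d where "\<forall>t\<in>Pow {..<s + 3}. (\<Sum>a\<in>Pow {..<s + 3}. c a * sign_row s a t) = f t"
    "\<forall>t\<in>Pow {..<s + 3}. (\<Sum>a\<in>Pow {..<s + 3}. d a * sign_row s a t) = g t"
    using assms by (auto simp: row_span_def)
  then show ?thesis unfolding row_span_def
    by (intro exI[of _ "\<lambda>a. c a + d a"]) (simp add: distrib_right sum.distrib)
qed

lemma row_span_diff:
  assumes "row_span s f" "row_span s g" shows "row_span s (\<lambda>t. f t - g t)"
  using row_span_add[OF assms(1) row_span_scale[OF assms(2), of "-1"]] by simp

lemma row_span_sum:
  assumes "finite B" "\<And>b. b \<in> B \<Longrightarrow> row_span s (f b)" shows "row_span s (\<lambda>t. \<Sum>b\<in>B. f b t)"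
  using assms
proof (induction B)
  case empty
  show ?case unfolding row_span_def by (rule exI[of _ "\<lambda>_. 0"]) simp
next
  case (insert b B)
  then show ?case by (simp add: row_span_add)
qed

lemma row_span_low: "a \<subseteq> {..<s + 3} \<Longrightarrow> \<not> active s a \<Longrightarrow> row_span s (chi a)"
  by (rule row_span_cong[OF row_span_row[of a s]]) (auto simp: sign_row_def)

text \<open>The matrix is triangular in the characters. The measure is the position in the chain,
  and the row of \<open>a\<close> contains \<open>chi a\<close> with nonzero coefficient besides
  characters that are inactive or earlier in the chain.\<close>

lemma row_span_chi:
  assumes "a \<subseteq> {..<s + 3}"
  shows "row_span s (chi a)"
  using assms
proof (induction a rule: measure_induct_rule[of "\<lambda>a. 2 * idx s a + of_bool (s + 2 \<in> a)"])
  case (less a)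
  note a = less.prems
  have fa: "finite a" using a finite_subset by auto
  consider (low) "\<not> active s a" | (full) "active s a" "s + 2 \<in> a"
    | (first) "active s a" "s + 2 \<notin> a" "idx s a = 0" | (link) "active s a" "s + 2 \<notin> a" "idx s a \<noteq> 0"
    by blast
  then show ?case
  proof cases
    case low
    with a show ?thesis by (rule row_span_low)
  next
    case first
    then show ?thesis by (intro row_span_cong[OF row_span_row[OF a]]) (auto simp: sign_row_def)
  next
    case link
    let ?p = "pred_set s a"
    note p = pred_set_props[OF a link(3)]
    have "2 * idx s ?p + of_bool (s + 2 \<in> ?p) < 2 * idx s a + of_bool (s + 2 \<in> a)"
      using p link(3) by simp
    from less.IH[OF this p(1)] have rp: "row_span s (chi ?p)" .
    have rd: "row_span s (chi (sym_diff a ?p))"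
      using a p(1) by (intro row_span_low not_active_sym_diff link(1) p(3)) auto
    have re: "row_span s (chi {})" by (rule row_span_low) (auto simp: active_def)
    have "row_span s (\<lambda>t. 2 * sign_row s a t + chi ?p t - chi {} t - chi (sym_diff a ?p) t)"
      by (intro row_span_diff row_span_add row_span_scale row_span_row a rp rd re)
    then show ?thesis
      by (rule row_span_cong) (use link in \<open>simp add: sign_row_def field_simps\<close>)
  next
    case full
    have "idx s (a - {s + 2}) = idx s a"
      unfolding idx_def by (intro arg_cong[of _ _ set_encode]) auto
    then have r1: "row_span s (chi (a - {s + 2}))"
      using less.IH[of "a - {s + 2}"] a full by auto
    have r2: "row_span s (chi b)" if b: "b \<in> Pow a - {a}" for b
    proof (cases "active s b")
      case False
      then show ?thesis using a b by (intro row_span_low) auto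
    next
      case True
      \<comment> \<open>A proper active subset either lacks \<open>s + 2\<close> and keeps all
        elements below \<open>s\<close>, or has a smaller index.\<close>
      have "2 * idx s b + of_bool (s + 2 \<in> b) < 2 * idx s a + of_bool (s + 2 \<in> a)"
      proof (cases "b \<inter> {..<s} = a \<inter> {..<s}")
        case True
        then have "s + 2 \<notin> b"
          using active_full_eq[OF a full] active_full_eq[of b s] \<open>active s b\<close> a b by auto
        then show ?thesis using True full by (simp add: idx_def)
      next
        case False
        then have "idx s b < idx s a"
          unfolding idx_def using b by (intro set_encode_psubset) auto
        then show ?thesis by auto
      qed
      from less.IH[OF this] show ?thesis using a b by auto
    qed
    \<comment> \<open>The row is solved for the indicator of disjointness and then, by expanding
      that over \<open>Pow a\<close>, for \<open>chi a\<close>.\<close>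
    have "row_span s (\<lambda>t. 2 ^ card a / 2 * (chi (a - {s + 2}) t - sign_row s a t)
        - (\<Sum>b\<in>Pow a - {a}. chi b t))"
      by (intro row_span_diff row_span_scale row_span_row row_span_sum a r1 r2) (use fa in auto)
    moreover have "2 ^ card a / 2 * (chi (a - {s + 2}) t - sign_row s a t)
        - (\<Sum>b\<in>Pow a - {a}. chi b t) = chi a t" for t
    proof -
      have "(\<Sum>b\<in>Pow a. chi b t) = chi a t + (\<Sum>b\<in>Pow a - {a}. chi b t)"
        using fa by (subst sum.remove[of _ a]) auto
      moreover have "2 ^ card a / 2 * (chi (a - {s + 2}) t - sign_row s a t) = 2 ^ card a * of_bool (a \<inter> t = {})"
        using full by (simp add: sign_row_def)
      moreover have "2 ^ card a * of_bool (a \<inter> t = {}) = (\<Sum>b\<in>Pow a. chi b t)"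
        unfolding disjoint_indicator_chi[OF fa] by simp
      ultimately show ?thesis by (simp only: add_diff_cancel_right')
    qed
    ultimately show ?thesis by (simp add: row_span_def)
  qed
qed

lemma row_span_all: "row_span s h"
proof -
  let ?X = "{..<s + 3}"
  have "row_span s (\<lambda>t. \<Sum>a\<in>Pow ?X. (\<Sum>u\<in>Pow ?X. h u * chi a u) / 2 ^ card ?X * chi a t)"
    by (intro row_span_sum row_span_scale row_span_chi) auto
  then show ?thesis
    by (rule row_span_cong) (rule chi_expansion[symmetric], auto)
qed

section \<open>Local correction from a sign matrix\<close>

primrec affine_tree ::
  "(real \<times> 'x) list \<Rightarrow> real \<Rightarrow> ('x, real, real) query_tree" where
  "affine_tree [] acc = Output acc"
| "affine_tree (cx # l) acc = Query (snd cx) (\<lambda>y. affine_tree l (acc + fst cx * y))"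

lemma run_affine_tree: "run f (affine_tree l acc) = acc + (\<Sum>(c, x)\<leftarrow>l. c * f x)"
  by (induction l arbitrary: acc) auto

lemma queries_affine_tree: "queries f (affine_tree l acc) = map snd l"
  by (induction l arbitrary: acc) auto

lemma finite_cube [simp]: "finite (cube n)"
  by (simp add: cube_def finite_PiE)

lemma card_cube: "card (cube n) = 2 ^ n"
  by (simp add: cube_def card_PiE numeral_2_eq_2)

lemma cube_nonempty: "cube n \<noteq> {}"
  by (simp add: cube_def PiE_eq_empty_iff)

text \<open>Restricted to \<open>{1..n}\<close> because the points of \<open>cube n\<close> are
  extensional functions.\<close>

definition flip :: "nat \<Rightarrow> (nat \<Rightarrow> real) \<Rightarrow> (nat \<Rightarrow> real) \<Rightarrow> nat \<Rightarrow> real" where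
  "flip n a m = (\<lambda>i\<in>{1..n}. if m i = 1 then a i else 1 - a i)"

lemma flip_in_cube: "a \<in> cube n \<Longrightarrow> flip n a m \<in> cube n"
  unfolding cube_def flip_def by (fastforce simp: PiE_iff)

text \<open>Coordinate \<open>i\<close> of a query is \<open>1 / 2 + (a i - 1 / 2) * m r i\<close>,
  affine in the sign; the combination therefore returns \<open>a i\<close>, and it commutes with the
  affine \<open>P\<close> since its coefficients sum to \<open>1\<close>.\<close>

lemma affine_combination_flip:
  assumes P: "P \<in> poly_deg_le_1 n" and a: "a \<in> cube n"
    and pm: "\<And>r i. r \<in> R \<Longrightarrow> i \<in> {1..n} \<Longrightarrow> m r i \<in> {1, -1}"
    and c: "sum c R = 1" "\<And>i. i \<in> {1..n} \<Longrightarrow> (\<Sum>r\<in>R. c r * m r i) = 1"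
  shows "(\<Sum>r\<in>R. c r * P (flip n a (m r))) = P a"
proof -
  obtain b0 b where P_eq: "\<And>x. x \<in> cube n \<Longrightarrow> P x = b0 + (\<Sum>i = 1..n. b i * x i)"
    using P by (auto simp: poly_deg_le_1_def)
  have val: "flip n a (m r) i = 1 / 2 + (a i - 1 / 2) * m r i" if "r \<in> R" "i \<in> {1..n}" for r i
    using pm[OF that] that by (auto simp: flip_def)
  have coord: "(\<Sum>r\<in>R. c r * flip n a (m r) i) = a i" if i: "i \<in> {1..n}" for i
  proof -
    have "(\<Sum>r\<in>R. c r * flip n a (m r) i) = (\<Sum>r\<in>R. c r * (1 / 2) + (a i - 1 / 2) * (c r * m r i))"
      by (intro sum.cong refl) (simp add: val[OF _ i] algebra_simps)
    also have "\<dots> = sum c R * (1 / 2) + (a i - 1 / 2) * (\<Sum>r\<in>R. c r * m r i)"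
      by (simp only: sum.distrib sum_distrib_left sum_distrib_right)
    finally show ?thesis using c i by simp
  qed
  have "(\<Sum>r\<in>R. c r * P (flip n a (m r)))
      = (\<Sum>r\<in>R. c r * b0 + (\<Sum>i = 1..n. b i * (c r * flip n a (m r) i)))"
    by (intro sum.cong refl) (simp add: P_eq flip_in_cube a distrib_left sum_distrib_left mult_ac)
  also have "\<dots> = sum c R * b0 + (\<Sum>i = 1..n. b i * (\<Sum>r\<in>R. c r * flip n a (m r) i))"
    unfolding sum.distrib sum_distrib_left sum_distrib_right by (subst sum.swap) simp
  also have "\<dots> = b0 + (\<Sum>i = 1..n. b i * a i)"
    using c coord by simp
  finally show ?thesis using P_eq a by simp
qed

text \<open>On \<open>T\<close> the two indicators are \<open>(1 + g t) / 2\<close> and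
  \<open>(1 - g t) / 2\<close>.\<close>

lemma prob_sign_le:
  fixes p :: "'t pmf"
  assumes T: "finite T" "set_pmf p \<subseteq> T" and g: "\<And>t. t \<in> T \<Longrightarrow> g t \<in> {1, -1 :: real}"
    and bias: "\<bar>\<Sum>t\<in>T. pmf p t * g t\<bar> \<le> \<epsilon>"
  shows "measure_pmf.prob p {t. g t = 1} \<le> (1 + \<epsilon>) / 2"
    "measure_pmf.prob p {t. g t \<noteq> 1} \<le> (1 + \<epsilon>) / 2"
proof -
  have prob: "measure_pmf.prob p A = (\<Sum>t\<in>T. pmf p t * indicator A t)" for A
  proof -
    have "measure_pmf.prob p A = measure_pmf.prob p (A \<inter> T)"
      using T(2) by (intro measure_eq_AE) (auto simp: AE_measure_pmf_iff)
    also have "\<dots> = sum (pmf p) (A \<inter> T)"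
      using T(1) by (simp add: measure_measure_pmf_finite)
    also have "\<dots> = (\<Sum>t\<in>T. pmf p t * indicator A t)"
      using T(1) by (simp add: sum.inter_restrict Int_commute indicator_def if_distrib cong: if_cong)
    finally show ?thesis .
  qed
  have one: "(\<Sum>t\<in>T. pmf p t) = 1"
    using T by (rule sum_pmf_eq_1)
  have "(\<Sum>t\<in>T. pmf p t * indicator {t. g t = 1} t) = (\<Sum>t\<in>T. pmf p t / 2 + pmf p t * g t / 2)"
    by (intro sum.cong refl) (use g in \<open>force simp: indicator_def\<close>)
  also have "\<dots> = (1 + (\<Sum>t\<in>T. pmf p t * g t)) / 2"
    using one by (simp add: sum.distrib flip: sum_divide_distrib)
  finally show "measure_pmf.prob p {t. g t = 1} \<le> (1 + \<epsilon>) / 2"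
    using abs_le_D1[OF bias] by (simp add: prob)
  have "(\<Sum>t\<in>T. pmf p t * indicator {t. g t \<noteq> 1} t) = (\<Sum>t\<in>T. pmf p t / 2 - pmf p t * g t / 2)"
    by (intro sum.cong refl) (use g in \<open>force simp: indicator_def\<close>)
  also have "\<dots> = (1 - (\<Sum>t\<in>T. pmf p t * g t)) / 2"
    using one by (simp add: sum_subtractf flip: sum_divide_distrib)
  finally show "measure_pmf.prob p {t. g t \<noteq> 1} \<le> (1 + \<epsilon>) / 2"
    using abs_le_D2[OF bias] by (simp add: prob)
qed

text \<open>The coordinates are independent and each hits its target with probability at most
  \<open>(1 + 1 / n) / 2\<close>; moreover
  \<open>(1 + 1 / n) ^ n \<le> exp 1 \<le> 3\<close>.\<close>

lemma prob_flip_eq_le: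
  fixes p :: "'t pmf"
  assumes T: "finite T" "set_pmf p \<subseteq> T" and g: "\<And>t. t \<in> T \<Longrightarrow> g t \<in> {1, -1 :: real}"
    and bias: "\<bar>\<Sum>t\<in>T. pmf p t * g t\<bar> \<le> 1 / real n" and n: "n \<ge> 1"
    and a: "a \<in> cube n" and x: "x \<in> cube n"
  shows "measure_pmf.prob (Pi_pmf {1..n} d (\<lambda>_. p)) {\<tau>. flip n a (\<lambda>i. g (\<tau> i)) = x} \<le> 3 / 2 ^ n"
proof -
  let ?Q = "Pi_pmf {1..n} d (\<lambda>_. p)"
  let ?B = "\<lambda>i. {t. (if g t = 1 then a i else 1 - a i) = x i}"
  have "measure_pmf.prob ?Q {\<tau>. flip n a (\<lambda>i. g (\<tau> i)) = x} \<le> measure_pmf.prob ?Q (PiE_dflt {1..n} d ?B)"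
  proof (rule measure_pmf.finite_measure_mono_AE)
    show "AE \<tau> in ?Q. \<tau> \<in> {\<tau>. flip n a (\<lambda>i. g (\<tau> i)) = x} \<longrightarrow> \<tau> \<in> PiE_dflt {1..n} d ?B"
      by (auto simp: AE_measure_pmf_iff set_Pi_pmf PiE_dflt_def flip_def)
  qed simp
  also have "\<dots> = (\<Prod>i\<in>{1..n}. measure_pmf.prob p (?B i))"
    by (simp add: measure_Pi_pmf_PiE_dflt)
  also have "\<dots> \<le> (\<Prod>i\<in>{1..n}. (1 + 1 / real n) / 2)"
  proof (rule prod_mono, intro conjI)
    fix i assume i: "i \<in> {1..n}"
    have "a i \<in> {0, 1}" "x i \<in> {0, 1}" using a x i by (auto simp: cube_def PiE_iff)
    then have "?B i = (if x i = a i then {t. g t = 1} else {t. g t \<noteq> 1})" by auto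
    then show "measure_pmf.prob p (?B i) \<le> (1 + 1 / real n) / 2"
      using prob_sign_le[OF T g bias] by (simp split: if_split)
  qed simp
  also have "\<dots> = (1 + 1 / real n) ^ n / 2 ^ n" by (simp add: power_divide)
  also have "\<dots> \<le> exp 1 / 2 ^ n"
  proof (rule divide_right_mono)
    have "(1 + 1 / real n) ^ n \<le> exp (1 / real n) ^ n"
      by (intro power_mono exp_ge_add_one_self) (auto intro: add_nonneg_nonneg)
    also have "\<dots> = exp 1" using n by (simp flip: exp_of_nat_mult)
    finally show "(1 + 1 / real n) ^ n \<le> exp 1" .
  qed simp
  also have "\<dots> \<le> 3 / 2 ^ n" using exp_le by (intro divide_right_mono) auto
  finally show ?thesis .
qed

lemma prob_flip_error_le:
  fixes p :: "'t pmf"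
  assumes T: "finite T" "set_pmf p \<subseteq> T" and g: "\<And>t. t \<in> T \<Longrightarrow> g t \<in> {1, -1 :: real}"
    and bias: "\<bar>\<Sum>t\<in>T. pmf p t * g t\<bar> \<le> 1 / real n" and n: "n \<ge> 1"
    and a: "a \<in> cube n"
  shows "measure_pmf.prob (Pi_pmf {1..n} d (\<lambda>_. p))
      {\<tau>. f (flip n a (\<lambda>i. g (\<tau> i))) \<noteq> P (flip n a (\<lambda>i. g (\<tau> i)))} \<le> 3 * rel_dist n f P"
proof -
  let ?Q = "Pi_pmf {1..n} d (\<lambda>_. p)" and ?x = "\<lambda>\<tau>. flip n a (\<lambda>i. g (\<tau> i))"
  let ?E = "cube n \<inter> {x. f x \<noteq> P x}"
  have "{\<tau>. f (?x \<tau>) \<noteq> P (?x \<tau>)} = (\<Union>x\<in>?E. {\<tau>. ?x \<tau> = x})"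
    using flip_in_cube[OF a] by auto
  then have "measure_pmf.prob ?Q {\<tau>. f (?x \<tau>) \<noteq> P (?x \<tau>)}
      \<le> (\<Sum>x\<in>?E. measure_pmf.prob ?Q {\<tau>. ?x \<tau> = x})"
    using measure_pmf.finite_measure_subadditive_finite[of ?E "\<lambda>x. {\<tau>. ?x \<tau> = x}"] by simp
  also have "\<dots> \<le> (\<Sum>x\<in>?E. 3 / 2 ^ n)"
    by (intro sum_mono prob_flip_eq_le[OF T g bias n a]) auto
  also have "\<dots> = 3 * rel_dist n f P"
    using cube_nonempty[of n] by (simp add: rel_dist_def measure_pmf_of_set card_cube)
  finally show ?thesis .
qed

text \<open>Only the query points are random; the coefficients \<open>c\<close> are fixed. The
  output is right whenever no query meets an error, and a union bound over the rows controls that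
  event.\<close>

lemma local_correction_of_sign_matrix:
  fixes p :: "'t pmf" and g :: "'r \<Rightarrow> 't \<Rightarrow> real"
  assumes fin: "finite R" "finite T" and T: "set_pmf p \<subseteq> T"
    and g: "\<And>r t. r \<in> R \<Longrightarrow> t \<in> T \<Longrightarrow> g r t \<in> {1, -1}"
    and bias: "\<And>r. r \<in> R \<Longrightarrow> \<bar>\<Sum>t\<in>T. pmf p t * g r t\<bar> \<le> 1 / real n"
    and c: "sum c R = 1" "\<And>t. t \<in> T \<Longrightarrow> (\<Sum>r\<in>R. c r * g r t) = 1"
    and n: "n \<ge> 1" and \<delta>: "real (card R) * (3 * \<delta>) \<le> 1 / 4"
  shows "has_local_correction n (poly_deg_le_1 n) \<delta> (card R)"
proof -
  obtain rs where rs: "set rs = R" "distinct rs" using finite_distinct_list[OF fin(1)] by auto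
  define d :: 't where "d = undefined"
  define Q where "Q = Pi_pmf {1..n} d (\<lambda>_. p)"
  define pt where "pt a \<tau> r = flip n a (\<lambda>i. g r (\<tau> i))" for a \<tau> r
  define alg where "alg a \<tau> = affine_tree (map (\<lambda>r. (c r, pt a \<tau> r)) rs) 0" for a \<tau>
  have run: "run f (alg a \<tau>) = (\<Sum>r\<in>R. c r * f (pt a \<tau> r))" for f a \<tau>
    unfolding alg_def run_affine_tree
    by (simp add: o_def sum_list_distinct_conv_sum_set rs)
  have q: "queries f (alg a \<tau>) = map (pt a \<tau>) rs" for f a \<tau>
    by (simp add: alg_def queries_affine_tree o_def)
  have len: "length rs = card R" using rs distinct_card by metis
  show ?thesis unfolding has_local_correction_def
  proof (intro exI[of _ "\<lambda>a. map_pmf (alg a) Q"] conjI ballI allI impI)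
    fix a tr f assume a: "a \<in> cube n" and tr: "tr \<in> set_pmf (map_pmf (alg a) Q)"
    then show "length (queries f tr) \<le> card R" by (auto simp: q len)
    show "set (queries f tr) \<subseteq> cube n"
      using tr a by (auto simp: q pt_def flip_in_cube)
  next
    fix f P a assume P: "P \<in> poly_deg_le_1 n" and dist: "rel_dist n f P \<le> \<delta>" and a: "a \<in> cube n"
    let ?G = "{\<tau>. run f (alg a \<tau>) = P a}" and ?bad = "\<lambda>r. {\<tau>. f (pt a \<tau> r) \<noteq> P (pt a \<tau> r)}"
    have "measure_pmf.prob Q (- ?G) \<le> measure_pmf.prob Q (\<Union>r\<in>R. ?bad r)"
    proof (rule measure_pmf.finite_measure_mono_AE)
      have "run f (alg a \<tau>) = P a"
        if \<tau>: "\<tau> \<in> set_pmf Q" and ok: "\<forall>r\<in>R. f (pt a \<tau> r) = P (pt a \<tau> r)" for \<tau>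
      proof -
        have \<tau>T: "\<tau> i \<in> T" if "i \<in> {1..n}" for i
          using \<tau> that T by (auto simp: Q_def set_Pi_pmf PiE_dflt_def)
        have "run f (alg a \<tau>) = (\<Sum>r\<in>R. c r * P (pt a \<tau> r))"
          unfolding run using ok by (intro sum.cong) auto
        also have "\<dots> = P a"
          unfolding pt_def
          using \<tau>T by (intro affine_combination_flip P a g c) auto
        finally show ?thesis .
      qed
      then show "AE \<tau> in Q. \<tau> \<in> - ?G \<longrightarrow> \<tau> \<in> (\<Union>r\<in>R. ?bad r)"
        by (auto simp: AE_measure_pmf_iff)
    qed simp
    also have "\<dots> \<le> (\<Sum>r\<in>R. measure_pmf.prob Q (?bad r))"
      using fin(1) by (intro measure_pmf.finite_measure_subadditive_finite) auto
    also have "\<dots> \<le> (\<Sum>r\<in>R. 3 * \<delta>)"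
    proof (rule sum_mono)
      fix r assume r: "r \<in> R"
      have "measure_pmf.prob Q (?bad r) \<le> 3 * rel_dist n f P"
        unfolding Q_def pt_def
        by (rule prob_flip_error_le[OF fin(2) T g[OF r] bias[OF r] n a])
      then show "measure_pmf.prob Q (?bad r) \<le> 3 * \<delta>" using dist by simp
    qed
    also have "\<dots> \<le> 1 / 4" using \<delta> by simp
    finally have "measure_pmf.prob Q (- ?G) \<le> 1 / 4" .
    moreover have "measure_pmf.prob Q (- ?G) = 1 - measure_pmf.prob Q ?G"
      using measure_pmf.prob_compl[of ?G Q] by (simp add: Compl_eq_Diff_UNIV)
    ultimately show "measure_pmf.prob (map_pmf (alg a) Q) {T. run f T = P a} \<ge> 3 / 4"
      by (simp add: vimage_def)
  qed
qed

section \<open>The corrector from the matrix, and the choice of its size\<close>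

lemma local_correction_of_coef:
  assumes n: "n \<ge> 1" "real n \<le> coef (2 ^ s)" and \<delta>: "2 ^ (s + 3) * (3 * \<delta>) \<le> 1 / 4"
  shows "has_local_correction n (poly_deg_le_1 n) \<delta> (2 ^ (s + 3))"
proof -
  define T where "T = Pow {..<s + 3}"
  define Z where "Z = (\<Sum>t\<in>T. \<bar>weight s t\<bar>)"
  have finT: "finite T" and cardT: "card T = 2 ^ (s + 3)" and eT: "{} \<in> T"
    by (auto simp: T_def card_Pow)
  have Zn: "Z \<ge> real n" using sum_abs_weight_ge[of s] n(2) by (simp add: Z_def T_def)
  then have Z: "Z > 0" using n(1) by simp
  define f where "f t = (if t \<in> T then \<bar>weight s t\<bar> / Z else 0)" for t
  have f0: "f t \<ge> 0" for t using Z by (simp add: f_def)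
  have "(\<Sum>t\<in>T. f t) = (\<Sum>t\<in>T. \<bar>weight s t\<bar>) / Z"
    by (simp add: f_def sum_divide_distrib)
  then have "(\<Sum>t\<in>T. f t) = 1" using Z by (simp add: Z_def)
  moreover have "(\<integral>\<^sup>+ t. ennreal (f t) \<partial>count_space UNIV) = (\<Sum>t\<in>T. ennreal (f t))"
    by (rule nn_integral_count_space'[OF finT]) (auto simp: f_def)
  ultimately have f1: "(\<integral>\<^sup>+ t. ennreal (f t) \<partial>count_space UNIV) = 1"
    using f0 by (simp add: sum_ennreal)
  define p where "p = embed_pmf f"
  have pmf: "pmf p t = f t" for t
    unfolding p_def by (rule pmf_embed_pmf[OF f0 f1])
  \<comment> \<open>Zero weights get sign \<open>1\<close>, so that every entry of \<open>g\<close>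
    below is a sign.\<close>
  define sg where "sg t = (if weight s t < 0 then -1 else 1 :: real)" for t
  have sg2: "sg t * sg t = 1" "sg t \<in> {1, -1}" and sgw: "\<bar>weight s t\<bar> * sg t = weight s t" for t
    by (auto simp: sg_def)
  \<comment> \<open>Normalising the column \<open>{}\<close> to \<open>1\<close> makes the coefficients sum to \<open>1\<close>.\<close>
  define \<epsilon> where "\<epsilon> r = sign_row s r {} * sg {}" for r
  have row: "sign_row s r t \<in> {1, -1}" if "r \<in> T" for r t
    using sign_row_cases[of r s t] that by (auto simp: T_def)
  have eps: "\<epsilon> r \<in> {1, -1}" if "r \<in> T" for r
    using row[OF that, of "{}"] sg2(2)[of "{}"] by (auto simp: \<epsilon>_def)
  have eps2: "\<epsilon> r * \<epsilon> r = 1" if "r \<in> T" for r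
    using eps[OF that] by auto
  define g where "g r t = \<epsilon> r * sg t * sign_row s r t" for r t
  \<comment> \<open>Here invertibility enters. Column \<open>t\<close> of \<open>g\<close> carries
    the factor \<open>sg t\<close>, which turns a combination of rows equal to \<open>sg\<close>
    into the constant \<open>1\<close>.\<close>
  obtain c where c: "\<And>t. t \<in> T \<Longrightarrow> (\<Sum>r\<in>T. c r * sign_row s r t) = sg t"
    using row_span_all[of s sg] by (auto simp: row_span_def T_def)
  have "has_local_correction n (poly_deg_le_1 n) \<delta> (card T)"
  proof (rule local_correction_of_sign_matrix[where g = g and c = "\<lambda>r. \<epsilon> r * c r", OF finT finT])
    show "set_pmf p \<subseteq> T" by (auto simp: set_pmf_eq pmf f_def)
    show "g r t \<in> {1, -1}" if "r \<in> T" for r t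
      using eps[OF that] row[OF that, of t] sg2(2)[of t] by (auto simp: g_def)
    show "\<bar>\<Sum>t\<in>T. pmf p t * g r t\<bar> \<le> 1 / real n" if r: "r \<in> T" for r
    proof -
      \<comment> \<open>Mass times sign restores \<open>weight\<close>, so the bias is, up to sign,
        an entry of the matrix-vector product divided by \<open>Z\<close>.\<close>
      have "(\<Sum>t\<in>T. pmf p t * g r t) = (\<Sum>t\<in>T. \<epsilon> r / Z * (\<bar>weight s t\<bar> * sg t * sign_row s r t))"
        by (intro sum.cong refl) (simp add: pmf f_def g_def)
      also have "\<dots> = \<epsilon> r / Z * (\<Sum>t\<in>T. weight s t * sign_row s r t)"
        by (simp only: sgw sum_distrib_left)
      finally have eq: "(\<Sum>t\<in>T. pmf p t * g r t) = \<epsilon> r / Z * (\<Sum>t\<in>T. weight s t * sign_row s r t)" .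
      have "(\<Sum>t\<in>T. weight s t * sign_row s r t) \<in> {0, 1}"
        using weight_sign_row[of r s] r by (simp add: T_def)
      then have "\<bar>\<Sum>t\<in>T. pmf p t * g r t\<bar> \<le> 1 / Z"
        unfolding eq using eps[OF r] Z by auto
      also have "\<dots> \<le> 1 / real n" using Zn n(1) by (intro divide_left_mono) auto
      finally show ?thesis .
    qed
    have sum: "(\<Sum>r\<in>T. \<epsilon> r * c r * g r t) = 1" if "t \<in> T" for t
    proof -
      have "\<epsilon> r * c r * g r t = sg t * (c r * sign_row s r t)" if "r \<in> T" for r
        using eps[OF that] by (auto simp: g_def)
      then have "(\<Sum>r\<in>T. \<epsilon> r * c r * g r t) = sg t * (\<Sum>r\<in>T. c r * sign_row s r t)"
        unfolding sum_distrib_left by (intro sum.cong refl)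
      then show ?thesis using c[OF that] sg2(1) by simp
    qed
    then show "(\<Sum>r\<in>T. \<epsilon> r * c r * g r t) = 1" if "t \<in> T" for t using that by simp
    have "g r {} = 1" if "r \<in> T" for r
      using eps2[OF that] by (simp add: g_def \<epsilon>_def mult_ac)
    then show "(\<Sum>r\<in>T. \<epsilon> r * c r) = 1"
      using sum[OF eT] by simp
    show "real (card T) * (3 * \<delta>) \<le> 1 / 4" using \<delta> by (simp add: cardT)
  qed (use n in auto)
  then show ?thesis by (simp add: cardT)
qed

text \<open>For \<open>L = log 2 n\<close> the first bound gives
  \<open>n \<le> coef (2 ^ s)\<close>, and the second limits the \<open>2 ^ (s + 3)\<close> queries.
  The least \<open>s\<close> with the first bound works, since failure at \<open>s - 1\<close>
  bounds \<open>2 ^ s\<close> from above.\<close>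

lemma exists_exponent:
  fixes L :: real
  assumes L: "L > 1"
  shows "\<exists>s. 2 * L \<le> 2 ^ s * (real s + 2) \<and> 2 ^ (s + 3) * log 2 L \<le> 64 * L"
proof -
  define Q where "Q s \<longleftrightarrow> 2 * L \<le> 2 ^ s * (real s + 2)" for s :: nat
  obtain m where m: "2 * L < real m" using reals_Archimedean2 by blast
  have "1 * real m \<le> 2 ^ m * (real m + 2)" by (intro mult_mono) auto
  then have "Q m" using m by (simp add: Q_def)
  then have "Q (LEAST s. Q s)" by (rule LeastI)
  moreover define s where "s = (LEAST s. Q s)"
  ultimately have Qs: "Q s" by simp
  have "s \<noteq> 0" using Qs L by (auto simp: Q_def intro: ccontr)
  then obtain u where u: "s = Suc u" using not0_implies_Suc by blast
  have "\<not> Q u" using not_less_Least[of u Q] u by (simp add: s_def)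
  then have small: "2 ^ u * (real u + 2) < 2 * L" by (simp add: Q_def)
  \<comment> \<open>Minimality gives \<open>2 ^ s * (s + 1) < 4 * L\<close>, so it remains to bound
    \<open>log 2 L\<close> by \<open>2 * (s + 1)\<close>.\<close>
  have "real (s + 2) \<le> real (2 ^ (s + 1))"
    unfolding of_nat_le_iff using less_exp[of "s + 1"] by linarith
  then have "real s + 2 \<le> 2 ^ (s + 1)" by simp
  then have "2 ^ s * (real s + 2) \<le> 2 ^ s * 2 ^ (s + 1)" by (intro mult_left_mono) auto
  then have "2 * L \<le> 2 ^ s * 2 ^ (s + 1)" using Qs unfolding Q_def by linarith
  moreover have "(2::real) ^ (2 * s) = 2 ^ s * 2 ^ s" by (simp only: mult_2 power_add)
  ultimately have "L \<le> 2 ^ (2 * s)" by simp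
  also have "\<dots> = 2 powr real (2 * s)" by (rule powr_realpow [symmetric]) simp
  finally have "log 2 L \<le> real (2 * s)" using L by (subst log_le_iff) linarith+
  then have "log 2 L \<le> 2 * (real u + 2)" using u by simp
  then have "2 ^ (s + 3) * log 2 L \<le> 2 ^ (s + 3) * (2 * (real u + 2))"
    by (intro mult_left_mono) auto
  also have "\<dots> = 32 * (2 ^ u * (real u + 2))" by (simp add: u power_add)
  also have "\<dots> \<le> 64 * L" using small by simp
  finally show ?thesis using Qs by (auto simp: Q_def)
qed

theorem theoremB1:
  "\<exists>c > (0::real). \<exists>C > (0::real). \<forall>n \<ge> (3::nat). \<forall>\<delta> :: real.
     \<delta> < c * log 2 (log 2 (real n)) / log 2 (real n) \<longrightarrow>
     (\<exists>q :: nat. real q \<le> C * log 2 (real n) / log 2 (log 2 (real n)) \<and>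
        has_local_correction n (poly_deg_le_1 n) \<delta> q)"
proof (rule exI[of _ "1 / 768"], rule conjI, simp, rule exI[of _ 64], intro conjI allI impI)
  \<comment> \<open>With at most \<open>64 * L / log 2 L\<close> queries, each wrong with
    probability at most \<open>3 * \<delta>\<close>, a total error of \<open>1 / 4\<close> leads to
    \<open>768 = 3 * 4 * 64\<close>.\<close>
  fix n :: nat and \<delta> :: real
  assume n: "3 \<le> n" and \<delta>: "\<delta> < 1 / 768 * log 2 (log 2 (real n)) / log 2 (real n)"
  define L where "L = log 2 (real n)"
  \<comment> \<open>\<open>n \<ge> 3\<close> makes the iterated logarithm positive, as the final
    division by it requires.\<close>
  have "log 2 2 < log 2 (real n)" using n by (subst log_less_cancel_iff) auto
  then have L: "L > 1" by (simp add: L_def)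
  then have LL: "log 2 L > 0" by simp
  obtain s where s: "2 * L \<le> 2 ^ s * (real s + 2)" "2 ^ (s + 3) * log 2 L \<le> 64 * L"
    using exists_exponent[OF L] by blast
  have "2 powr L = real n" using n by (simp add: L_def)
  then have "(real n)\<^sup>2 = 2 powr (2 * L)"
    by (simp only: mult_2 powr_add power2_eq_square)
  also have "\<dots> \<le> 2 powr (2 ^ s * (real s + 2))" using s(1) by simp
  also have "\<dots> = 2 powr real (2 ^ s * (s + 2))" by (simp add: algebra_simps)
  also have "\<dots> = 2 ^ (2 ^ s * (s + 2))" by (subst powr_realpow) auto
  also have "\<dots> \<le> (coef (2 ^ s))\<^sup>2" by (rule coef_power2_ge)
  finally have nc: "real n \<le> coef (2 ^ s)"
    by (rule power2_le_imp_le) (use coef_growth in \<open>auto intro: less_imp_le\<close>)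
  have "2 ^ (s + 3) * (3 * \<delta>) \<le> 2 ^ (s + 3) * (3 * (1 / 768 * log 2 L / L))"
    using \<delta> by (intro mult_left_mono) (auto simp: L_def)
  also have "\<dots> = (2 ^ (s + 3) * log 2 L) * (1 / (256 * L))" by simp
  also have "\<dots> \<le> (64 * L) * (1 / (256 * L))"
    using s(2) L by (intro mult_right_mono) auto
  also have "\<dots> = 1 / 4" using L by simp
  finally have "has_local_correction n (poly_deg_le_1 n) \<delta> (2 ^ (s + 3))"
    using n nc by (intro local_correction_of_coef) auto
  moreover have "real (2 ^ (s + 3)) \<le> 64 * L / log 2 L"
    using s(2) LL by (simp add: pos_le_divide_eq)
  ultimately show "\<exists>q. real q \<le> 64 * log 2 (real n) / log 2 (log 2 (real n)) \<and>
      has_local_correction n (poly_deg_le_1 n) \<delta> q"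
    unfolding L_def by (intro exI[of _ "2 ^ (s + 3)"] conjI)
qed auto

end
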